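(* Let $\theta\in(0,1)$, $\alpha>1$, $\mathbf{w}^0\in\Omega$, and $\epsilon_0>0$ with $f(\mathbf{w}^0)-f_*\le\epsilon_0$. Suppose $0<\epsilon\le\epsilon_0/4$ and $K=\lceil\log_\alpha(\epsilon_0/\epsilon)\rceil$. Let the positive integer $t_1$ be large enough so that there exists $\hat\epsilon_1\in(\epsilon,\epsilon_0/2)$ with which $f$ satisfies a local error bound condition on $\mathcal{S}_{\hat\epsilon_1}$ with exponent $\theta$ and constant $\hat c$, and $t_1=\frac{\alpha^2\hat c^2G^2}{\hat\epsilon_1^{2(1-\theta)}}$. Run R$^2$SG with parameters $t_1,K,\alpha,\theta$ from $\mathbf{w}^0$. Then with at most $S=\lceil\log_2(\hat\epsilon_1/\epsilon)\rceil+1$ calls of RSG, R$^2$SG finds a solution $\mathbf{w}^S$ such that $f(\mathbf{w}^S)-f_*\le2\epsilon$. The total number of iterations of R$^2$SG for obtaining this $2\epsilon$-optimal solution is upper bounded by $T_S=O\left(\frac{\hat c^2G^2}{\epsilon^{2(1-\theta)}}\lceil\log_\alpha(\frac{\epsilon_0}{\epsilon})\rceil\right)$, where $O(h(\epsilon))$ denotes a quantity bounded by $C\,h(\epsilon)$ for a constant $C>0$ independent of $\epsilon$.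
   Context: Problem: $f:\mathbb{R}^d\to(-\infty,+\infty]$ is lower semicontinuous and convex, $\Omega\subseteq\mathrm{dom}(f)$ is a closed convex subset of $\mathbb{R}^d$, $f_*:=\min_{\mathbf{w}\in\Omega}f(\mathbf{w})$ is attained, and $\Omega_*\subseteq\Omega$ is the (nonempty) set of minimizers of $f$ over $\Omega$. No smoothness or strong convexity is assumed. Bounded subgradients: there is a constant $G>0$ such that for every $\mathbf{w}\in\Omega$ the subdifferential $\partial f(\mathbf{w})$ is nonempty and $\|\mathbf{v}\|_2\le G$ for all $\mathbf{v}\in\partial f(\mathbf{w})$. $\mathcal{S}_\epsilon:=\{\mathbf{w}\in\Omega:f(\mathbf{w})\le f_*+\epsilon\}$. For $\mathbf{w}\in\Omega$, $\mathbf{w}^*$ denotes the point of $\Omega_*$ closest to $\mathbf{w}$ in Euclidean norm. $f$ satisfies a local error bound on $\mathcal{S}_\epsilon$ with exponent $\theta$ and constant $c\in(0,\infty)$ if $\|\mathbf{w}-\mathbf{w}^*\|_2\le c\,(f(\mathbf{w})-f_* )^\theta$ for all $\mathbf{w}\in\mathcal{S}_\epsilon$. Algorithm RSG$(\mathbf{w}_0,K,t,\alpha)$ (given $\epsilon_0$ and $G$): for $k=1,\dots,K$ let $\eta_k=\epsilon_0/(\alpha^kG^2)$; set $\mathbf{x}_1=\mathbf{w}_{k-1}$ and, for $\tau=1,\dots,t$, $\mathbf{x}_{\tau+1}=\Pi_\Omega[\mathbf{x}_\tau-\eta_k\mathbf{g}_\tau]$, where $\mathbf{g}_\tau\in\partial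 f(\mathbf{x}_\tau)$ is an arbitrary subgradient returned by an oracle and $\Pi_\Omega$ is the Euclidean projection onto $\Omega$; set $\mathbf{w}_k=\frac1t\sum_{\tau=1}^t\mathbf{x}_\tau$. Output $\mathbf{w}_K$. This uses $tK$ iterations. Algorithm R$^2$SG (RSG with restarting), with inputs $t_1,K,\alpha,\theta$ and initial point $\mathbf{w}^0\in\Omega$: for $s=1,2,\dots,S$, let $\mathbf{w}^s=\mathrm{RSG}(\mathbf{w}^{s-1},K,t_s,\alpha)$, where $t_s=\lceil t_1\,2^{2(s-1)(1-\theta)}\rceil$. All calls of RSG use the same value $\epsilon_0$. The total number of iterations is $K\sum_{s=1}^St_s$. In the big-O bound, $t_1,\hat\epsilon_1,\hat c,\theta,\alpha,\epsilon_0,G$ and the problem are regarded as fixed. *)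

theory Defs
  imports "HOL-Analysis.Analysis"
begin

text \<open>Convex functions with values in \<open>(-\<infinity>, +\<infinity>]\<close> are modelled as \<open>ereal\<close>-valued functions;
  the value \<open>-\<infinity>\<close> has to be excluded separately. With \<open>0 * \<infinity> = 0\<close> in \<open>ereal\<close>, the inequality
  below is the usual one for such functions.\<close>

definition ereal_convex :: "('a::real_vector \<Rightarrow> ereal) \<Rightarrow> bool" where
  "ereal_convex f \<longleftrightarrow>
    (\<forall>x y. \<forall>u\<ge>0. \<forall>v\<ge>0. u + v = 1 \<longrightarrow>
      f (u *\<^sub>R x + v *\<^sub>R y) \<le> ereal u * f x + ereal v * f y)"

definition lower_semicont :: "('a::topological_space \<Rightarrow> ereal) \<Rightarrow> bool" where
  "lower_semicont f \<longleftrightarrow> (\<forall>x. f x \<le> Liminf (at x) f)"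

definition eff_dom :: "('a \<Rightarrow> ereal) \<Rightarrow> 'a set" where
  "eff_dom f = {x. f x < \<infinity>}"

definition subdifferential :: "('a::real_inner \<Rightarrow> ereal) \<Rightarrow> 'a \<Rightarrow> 'a set" where
  "subdifferential f w = {v. \<forall>u. f w + ereal (v \<bullet> (u - w)) \<le> f u}"

text \<open>\<open>opt_value\<close> is a minimum exactly when \<open>opt_set\<close> is nonempty.\<close>

definition opt_value :: "('a \<Rightarrow> ereal) \<Rightarrow> 'a set \<Rightarrow> ereal" where
  "opt_value f \<Omega> = (INF w\<in>\<Omega>. f w)"

definition opt_set :: "('a \<Rightarrow> ereal) \<Rightarrow> 'a set \<Rightarrow> 'a set" where
  "opt_set f \<Omega> = {w \<in> \<Omega>. \<forall>u\<in>\<Omega>. f w \<le> f u}"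

definition sublevel_set :: "('a \<Rightarrow> ereal) \<Rightarrow> 'a set \<Rightarrow> real \<Rightarrow> 'a set" where
  "sublevel_set f \<Omega> \<epsilon> = {w \<in> \<Omega>. f w \<le> opt_value f \<Omega> + ereal \<epsilon>}"

text \<open>On the sublevel set \<open>f w - opt_value f \<Omega>\<close> is finite whenever the optimal value is, so
  \<open>real_of_ereal\<close> loses nothing.\<close>

definition local_error_bound ::
    "('a::euclidean_space \<Rightarrow> ereal) \<Rightarrow> 'a set \<Rightarrow> real \<Rightarrow> real \<Rightarrow> real \<Rightarrow> bool" where
  "local_error_bound f \<Omega> \<epsilon> \<theta> c \<longleftrightarrow>
    (\<forall>w \<in> sublevel_set f \<Omega> \<epsilon>.
      norm (w - closest_point (opt_set f \<Omega>) w)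
        \<le> c * real_of_ereal (f w - opt_value f \<Omega>) powr \<theta>)"

text \<open>\<open>sg_iterate \<Omega> \<eta> g x n\<close> is the iterate \<open>x\<^sub>\<tau>\<close> with \<open>\<tau> = n + 1\<close>. The oracle \<open>g\<close> takes the
  iteration index \<open>\<tau>\<close> in addition to the point, so that it need not return the same subgradient
  when a point is revisited; \<open>rsg\<close> and \<open>r2sg\<close> likewise pass it the stage \<open>k\<close> and the call \<open>s\<close>.
  Every sequence of oracle answers arising in a run is obtained in this way.\<close>

primrec sg_iterate ::
    "'a::euclidean_space set \<Rightarrow> real \<Rightarrow> (nat \<Rightarrow> 'a \<Rightarrow> 'a) \<Rightarrow> 'a \<Rightarrow> nat \<Rightarrow> 'a" where
  "sg_iterate \<Omega> \<eta> g x 0 = x"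
| "sg_iterate \<Omega> \<eta> g x (Suc n) =
    closest_point \<Omega> (sg_iterate \<Omega> \<eta> g x n - \<eta> *\<^sub>R g (Suc n) (sg_iterate \<Omega> \<eta> g x n))"

definition sg_average ::
    "'a::euclidean_space set \<Rightarrow> real \<Rightarrow> (nat \<Rightarrow> 'a \<Rightarrow> 'a) \<Rightarrow> 'a \<Rightarrow> nat \<Rightarrow> 'a" where
  "sg_average \<Omega> \<eta> g x t = (1 / real t) *\<^sub>R (\<Sum>\<tau>=1..t. sg_iterate \<Omega> \<eta> g x (\<tau> - 1))"

primrec rsg ::
    "'a::euclidean_space set \<Rightarrow> real \<Rightarrow> real \<Rightarrow> (nat \<Rightarrow> nat \<Rightarrow> 'a \<Rightarrow> 'a) \<Rightarrow> 'a \<Rightarrow> nat \<Rightarrow> nat \<Rightarrow> real \<Rightarrow> 'a"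
  where
  "rsg \<Omega> \<epsilon>0 G g w 0 t \<alpha> = w"
| "rsg \<Omega> \<epsilon>0 G g w (Suc k) t \<alpha> =
    sg_average \<Omega> (\<epsilon>0 / (\<alpha> ^ Suc k * G\<^sup>2)) (g (Suc k)) (rsg \<Omega> \<epsilon>0 G g w k t \<alpha>) t"

definition r2sg_t :: "nat \<Rightarrow> real \<Rightarrow> nat \<Rightarrow> nat" where
  "r2sg_t t1 \<theta> s = nat \<lceil>real t1 * 2 powr (2 * (real s - 1) * (1 - \<theta>))\<rceil>"

primrec r2sg ::
    "'a::euclidean_space set \<Rightarrow> real \<Rightarrow> real \<Rightarrow> (nat \<Rightarrow> nat \<Rightarrow> nat \<Rightarrow> 'a \<Rightarrow> 'a) \<Rightarrow> 'a
      \<Rightarrow> nat \<Rightarrow> nat \<Rightarrow> real \<Rightarrow> real \<Rightarrow> nat \<Rightarrow> 'a"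
  where
  "r2sg \<Omega> \<epsilon>0 G g w0 t1 K \<alpha> \<theta> 0 = w0"
| "r2sg \<Omega> \<epsilon>0 G g w0 t1 K \<alpha> \<theta> (Suc s) =
    rsg \<Omega> \<epsilon>0 G (g (Suc s)) (r2sg \<Omega> \<epsilon>0 G g w0 t1 K \<alpha> \<theta> s) K (r2sg_t t1 \<theta> (Suc s)) \<alpha>"

text \<open>Each call of \<open>rsg\<close> with \<open>K\<close> stages of \<open>t\<close> subgradient steps costs \<open>t * K\<close> iterations.\<close>

definition r2sg_iterations :: "nat \<Rightarrow> nat \<Rightarrow> real \<Rightarrow> nat \<Rightarrow> nat" where
  "r2sg_iterations t1 K \<theta> S = K * (\<Sum>s=1..S. r2sg_t t1 \<theta> s)"

definition subgradient_oracle ::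
    "('a::real_inner \<Rightarrow> ereal) \<Rightarrow> 'a set \<Rightarrow> (nat \<Rightarrow> nat \<Rightarrow> nat \<Rightarrow> 'a \<Rightarrow> 'a) \<Rightarrow> bool" where
  "subgradient_oracle f \<Omega> g \<longleftrightarrow> (\<forall>s k \<tau>. \<forall>x\<in>\<Omega>. g s k \<tau> x \<in> subdifferential f x)"

end

theory Submission
  imports Defs
begin

text \<open>
  Write \<open>m\<close> for the optimal value. On \<open>\<Omega>\<close> the function is finite, and the bounded subgradients
  make it convex and Lipschitz there, so everything can be done with a real-valued function.

  Three observations carry the proof. (1) Projected subgradient steps of length \<open>\<eta>\<close> give, against any
  comparison point \<open>u \<in> \<Omega>\<close>, an averaged iterate with
  \<open>F x - F u \<le> \<eta> G\<^sup>2 / 2 + \<parallel>x\<^sub>1 - u\<parallel>\<^sup>2 / (2 \<eta> t)\<close> (\<open>sg_average_gap\<close>). (2) The comparison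
  point should not be a minimizer but the point \<open>u\<close> of the \<open>\<delta>\<close>-sublevel set closest to \<open>x\<^sub>1\<close>: convexity
  propagates the error bound, which speaks only about the sublevel set, to
  \<open>\<parallel>x\<^sub>1 - u\<parallel> \<le> c \<delta>\<^bsup>\<theta>-1\<^esup> (F x\<^sub>1 - m - \<delta>)\<close> for points outside it (\<open>near_sublevel_point\<close>).
  (3) Hence the excess of the gap over \<open>\<delta>\<close> shrinks by the factor \<open>\<alpha>\<close> in each stage of RSG as soon as
  \<open>t \<ge> (\<alpha> c G \<delta>\<^bsup>\<theta>-1\<^esup>)\<^sup>2\<close>, so that a call ends with gap at most \<open>\<delta> + \<epsilon>0 / \<alpha>\<^bsup>K\<^esup> \<le> \<delta> + \<epsilon>\<close>
  (\<open>rsg_gap\<close>).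

  The factor \<open>2\<^bsup>2(1-\<theta>)\<^esup>\<close> by which R2SG lengthens its calls is exactly what (3) needs in order that
  \<open>\<delta>\<close> can be halved from one call to the next, starting with \<open>\<delta> = \<epsilon>1\<close>; after \<open>\<lceil>log 2 (\<epsilon>1 / \<epsilon>)\<rceil>\<close>
  halvings \<open>\<delta> \<le> \<epsilon>\<close>. The error bound passes to smaller \<open>\<delta>\<close> for free, and the gap left by one call
  stays below the \<open>\<epsilon>0\<close> required to start the next. The call lengths grow geometrically, so their sum
  is dominated by the last one, which is of order \<open>c\<^sup>2 G\<^sup>2 / \<epsilon>\<^bsup>2(1-\<theta>)\<^esup>\<close>.\<close>

section \<open>Convex minimization with bounded subgradients\<close>

text \<open>Subgradient inequalities are only required between points of \<open>\<Omega>\<close>: no iterate leaves it.\<close>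

locale bounded_subgradients =
  fixes F :: "'a::euclidean_space \<Rightarrow> real" and \<Omega> :: "'a set" and G m :: real
  assumes closed_domain: "closed \<Omega>" and convex_domain: "convex \<Omega>"
    and G_pos: "G > 0"
    and min_attained: "\<exists>z\<in>\<Omega>. F z = m"
    and min_le: "w \<in> \<Omega> \<Longrightarrow> m \<le> F w"
    and subgradient_exists:
      "w \<in> \<Omega> \<Longrightarrow> \<exists>v. norm v \<le> G \<and> (\<forall>u\<in>\<Omega>. F w + v \<bullet> (u - w) \<le> F u)"
begin

definition bounded_subdifferential :: "'a \<Rightarrow> 'a set" where
  "bounded_subdifferential w = {v. norm v \<le> G \<and> (\<forall>u\<in>\<Omega>. F w + v \<bullet> (u - w) \<le> F u)}"

definition minimizers :: "'a set" where
  "minimizers = {w \<in> \<Omega>. F w = m}"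

definition sublevel :: "real \<Rightarrow> 'a set" where
  "sublevel \<delta> = {w \<in> \<Omega>. F w \<le> m + \<delta>}"

definition error_bound :: "real \<Rightarrow> real \<Rightarrow> real \<Rightarrow> bool" where
  "error_bound \<delta> \<theta> c \<longleftrightarrow>
    (\<forall>w \<in> sublevel \<delta>. norm (w - closest_point minimizers w) \<le> c * (F w - m) powr \<theta>)"

lemma domain_nonempty: "\<Omega> \<noteq> {}"
  using min_attained by blast

text \<open>A convex combination is compared with both end points through a single subgradient taken at the
  combination itself; its two linear terms cancel.\<close>

lemma convex_on_F: "convex_on \<Omega> F"
proof (intro convex_onI convex_domain)
  fix s :: real and x y
  assume s: "0 < s" "s < 1" and xy: "x \<in> \<Omega>" "y \<in> \<Omega>"
  define p where "p = (1 - s) *\<^sub>R x + s *\<^sub>R y"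
  have "p \<in> \<Omega>"
    unfolding p_def using convexD[OF convex_domain xy, of "1 - s" s] s by simp
  then obtain v where v: "\<forall>u\<in>\<Omega>. F p + v \<bullet> (u - p) \<le> F u"
    using subgradient_exists by blast
  have cancel: "(1 - s) * (v \<bullet> (x - p)) + s * (v \<bullet> (y - p)) = 0"
    by (simp add: p_def algebra_simps inner_simps)
  have "(1 - s) * (F p + v \<bullet> (x - p)) + s * (F p + v \<bullet> (y - p)) \<le> (1 - s) * F x + s * F y"
    using v xy s by (intro add_mono mult_left_mono) auto
  moreover have "(1 - s) * (F p + v \<bullet> (x - p)) + s * (F p + v \<bullet> (y - p)) = F p"
    using cancel by (simp add: algebra_simps)
  ultimately show "F ((1 - s) *\<^sub>R x + s *\<^sub>R y) \<le> (1 - s) * F x + s * F y"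
    by (simp add: p_def)
qed

lemma lipschitz_F: "G-lipschitz_on \<Omega> F"
proof (rule lipschitz_onI)
  have one_sided: "F x - F y \<le> G * dist x y" if xy: "x \<in> \<Omega>" "y \<in> \<Omega>" for x y
  proof -
    obtain v where v: "norm v \<le> G" "\<forall>u\<in>\<Omega>. F x + v \<bullet> (u - x) \<le> F u"
      using subgradient_exists[OF xy(1)] by blast
    have "F x - F y \<le> v \<bullet> (x - y)"
      using v(2) xy(2) by (force simp: inner_simps)
    also have "\<dots> \<le> norm v * norm (x - y)"
      by (rule norm_cauchy_schwarz)
    also have "\<dots> \<le> G * dist x y"
      using v(1) by (simp add: dist_norm mult_right_mono)
    finally show ?thesis .
  qed
  show "dist (F x) (F y) \<le> G * dist x y" if "x \<in> \<Omega>" "y \<in> \<Omega>" for x y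
    using one_sided[OF that] one_sided[OF that(2,1)] by (simp add: dist_real_def dist_commute abs_le_iff)
qed (use G_pos in simp)

lemma closed_sublevel: "closed (sublevel \<delta>)"
proof -
  have "sublevel \<delta> = \<Omega> \<inter> F -` {..m + \<delta>}"
    by (auto simp: sublevel_def)
  then show ?thesis
    using continuous_closed_preimage[OF lipschitz_on_continuous_on[OF lipschitz_F] closed_domain]
    by simp
qed

lemma minimizers_eq_sublevel: "minimizers = sublevel 0"
  using min_le by (force simp: minimizers_def sublevel_def)

lemma closest_minimizer: "closest_point minimizers w \<in> minimizers"
proof (rule closest_point_in_set)
  show "closed minimizers"
    by (simp add: minimizers_eq_sublevel closed_sublevel)
  show "minimizers \<noteq> {}"
    using min_attained by (auto simp: minimizers_def)
qed

lemma error_bound_antimono: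
  assumes "error_bound \<delta> \<theta> c" and "\<delta>' \<le> \<delta>"
  shows "error_bound \<delta>' \<theta> c"
  using assms by (auto simp: error_bound_def sublevel_def)

text \<open>Let \<open>u\<close> be the point of the sublevel set closest to \<open>w\<close>, \<open>z\<close> the minimizer closest to \<open>u\<close> and \<open>D\<close>
  the gap at \<open>w\<close>. By convexity the segment from \<open>w\<close> to \<open>z\<close> has entered the sublevel set once the
  fraction \<open>\<lambda> = (D - \<delta>) / D\<close> of it is covered, so \<open>\<parallel>w - u\<parallel> \<le> \<lambda> \<parallel>w - z\<parallel>
  \<le> \<lambda> (\<parallel>w - u\<parallel> + \<parallel>u - z\<parallel>)\<close>. Solving for \<open>\<parallel>w - u\<parallel>\<close> leaves \<open>\<parallel>u - z\<parallel>\<close>, to which the error bound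
  applies.\<close>

lemma near_sublevel_point:
  assumes w: "w \<in> \<Omega>" and gap: "F w - m \<le> \<delta> + r" and "\<delta> > 0" "r \<ge> 0" "\<theta> \<ge> 0" "c \<ge> 0"
    and eb: "error_bound \<delta> \<theta> c"
  obtains u where "u \<in> sublevel \<delta>" "norm (w - u) \<le> c * \<delta> powr (\<theta> - 1) * r"
proof (cases "F w - m \<le> \<delta>")
  case True
  with w have "w \<in> sublevel \<delta>" by (simp add: sublevel_def)
  moreover have "norm (w - w) \<le> c * \<delta> powr (\<theta> - 1) * r"
    using assms by simp
  ultimately show ?thesis by (rule that)
next
  case False
  define D where "D = F w - m"
  define u where "u = closest_point (sublevel \<delta>) w"
  define z where "z = closest_point minimizers u"
  define l where "l = (D - \<delta>) / D"
  define p where "p = (1 - l) *\<^sub>R w + l *\<^sub>R z"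
  have D: "D > \<delta>" "D > 0" "D - \<delta> \<le> r"
    using False gap \<open>\<delta> > 0\<close> by (auto simp: D_def)
  have l: "0 \<le> l" "l \<le> 1" "(1 - l) * D = \<delta>"
    using D \<open>\<delta> > 0\<close> by (auto simp: l_def field_simps)
  have z: "z \<in> \<Omega>" "F z = m"
    using closest_minimizer[of u] by (auto simp: z_def minimizers_def)
  have "F p \<le> (1 - l) * F w + l * F z"
    unfolding p_def using convex_onD[OF convex_on_F l(1,2) w z(1)] .
  also have "\<dots> = m + \<delta>"
    using l(3) z(2) by (simp add: D_def algebra_simps)
  finally have p_in: "p \<in> sublevel \<delta>"
    using convexD[OF convex_domain w z(1), of "1 - l" l] l by (simp add: sublevel_def p_def)
  have u_in: "u \<in> sublevel \<delta>"
    unfolding u_def using closed_sublevel p_in by (intro closest_point_in_set) auto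
  have "norm (w - u) \<le> norm (w - p)"
    using closest_point_le[OF closed_sublevel p_in, of w] by (simp add: u_def dist_norm)
  also have "w - p = l *\<^sub>R (w - z)"
    by (simp add: p_def algebra_simps)
  also have "norm (l *\<^sub>R (w - z)) \<le> l * (norm (w - u) + norm (u - z))"
    using l(1) norm_triangle_ineq[of "w - u" "u - z"] by (simp add: mult_left_mono)
  finally have "(1 - l) * norm (w - u) \<le> l * norm (u - z)"
    by (simp add: algebra_simps)
  then have "D * ((1 - l) * norm (w - u)) \<le> D * (l * norm (u - z))"
    using D by (intro mult_left_mono) auto
  moreover have "D * l = D - \<delta>" "D * (1 - l) = \<delta>"
    using D by (auto simp: l_def field_simps)
  ultimately have solved: "\<delta> * norm (w - u) \<le> (D - \<delta>) * norm (u - z)"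
    by (metis mult.assoc)
  have "norm (u - z) \<le> c * (F u - m) powr \<theta>"
    using eb u_in by (auto simp: error_bound_def z_def)
  also have "\<dots> \<le> c * \<delta> powr \<theta>"
    using u_in min_le \<open>\<theta> \<ge> 0\<close> \<open>c \<ge> 0\<close>
    by (intro mult_left_mono powr_mono2) (auto simp: sublevel_def)
  finally have "norm (u - z) \<le> c * \<delta> powr \<theta>" .
  then have "\<delta> * norm (w - u) \<le> r * (c * \<delta> powr \<theta>)"
    using solved D \<open>r \<ge> 0\<close> by (meson order_trans mult_mono norm_ge_zero)
  then have "norm (w - u) \<le> c * \<delta> powr (\<theta> - 1) * r"
    using \<open>\<delta> > 0\<close> by (simp add: powr_diff field_simps)
  with u_in show ?thesis by (rule that)
qed

section \<open>Projected subgradient steps\<close>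

lemma sg_iterate_in_domain:
  assumes "x \<in> \<Omega>"
  shows "sg_iterate \<Omega> \<eta> h x n \<in> \<Omega>"
  by (induction n) (auto simp: assms closest_point_in_set closed_domain domain_nonempty)

lemma sg_average_in_domain:
  assumes x: "x \<in> \<Omega>" and "t > 0"
  shows "sg_average \<Omega> \<eta> h x t \<in> \<Omega>"
proof -
  have "(\<Sum>\<tau>=1..t. (1 / real t) *\<^sub>R sg_iterate \<Omega> \<eta> h x (\<tau> - 1)) \<in> \<Omega>"
    using \<open>t > 0\<close> by (intro convex_sum convex_domain sg_iterate_in_domain x) auto
  then show ?thesis
    by (simp add: sg_average_def scaleR_sum_right)
qed

text \<open>The projection does not increase the distance to \<open>u\<close>, and the subgradient inequality bounds the
  inner product in the expansion of \<open>\<parallel>x - \<eta> v - u\<parallel>\<^sup>2\<close>.\<close>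

lemma projected_step:
  assumes x: "x \<in> \<Omega>" and u: "u \<in> \<Omega>" and "\<eta> \<ge> 0" and v: "v \<in> bounded_subdifferential x"
  shows "2 * \<eta> * (F x - F u) + (norm (closest_point \<Omega> (x - \<eta> *\<^sub>R v) - u))\<^sup>2
    \<le> (norm (x - u))\<^sup>2 + \<eta>\<^sup>2 * G\<^sup>2"
proof -
  have "dist (closest_point \<Omega> (x - \<eta> *\<^sub>R v)) (closest_point \<Omega> u) \<le> dist (x - \<eta> *\<^sub>R v) u"
    by (intro closest_point_lipschitz convex_domain closed_domain domain_nonempty)
  then have "(norm (closest_point \<Omega> (x - \<eta> *\<^sub>R v) - u))\<^sup>2 \<le> (norm ((x - u) - \<eta> *\<^sub>R v))\<^sup>2"
    using u by (intro power_mono) (simp_all add: closest_point_self dist_norm algebra_simps)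
  also have "\<dots> = (norm (x - u))\<^sup>2 - 2 * \<eta> * (v \<bullet> (x - u)) + \<eta>\<^sup>2 * (norm v)\<^sup>2"
    by (simp only: power2_norm_eq_inner inner_simps)
       (simp add: inner_commute algebra_simps power2_eq_square)
  finally have expand: "(norm (closest_point \<Omega> (x - \<eta> *\<^sub>R v) - u))\<^sup>2
    \<le> (norm (x - u))\<^sup>2 - 2 * \<eta> * (v \<bullet> (x - u)) + \<eta>\<^sup>2 * (norm v)\<^sup>2" .
  have "F x - F u \<le> v \<bullet> (x - u)"
    using v u by (force simp: bounded_subdifferential_def inner_simps)
  then have "2 * \<eta> * (F x - F u) \<le> 2 * \<eta> * (v \<bullet> (x - u))"
    using \<open>\<eta> \<ge> 0\<close> by (intro mult_left_mono) auto
  moreover have "\<eta>\<^sup>2 * (norm v)\<^sup>2 \<le> \<eta>\<^sup>2 * G\<^sup>2"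
    using v by (intro mult_left_mono power_mono) (auto simp: bounded_subdifferential_def)
  ultimately show ?thesis
    using expand by linarith
qed

lemma sg_iterate_telescope:
  assumes x: "x \<in> \<Omega>" and u: "u \<in> \<Omega>" and "\<eta> \<ge> 0"
    and h: "\<And>\<tau> y. y \<in> \<Omega> \<Longrightarrow> h \<tau> y \<in> bounded_subdifferential y"
  shows "2 * \<eta> * (\<Sum>\<tau>=1..n. F (sg_iterate \<Omega> \<eta> h x (\<tau> - 1)) - F u)
      + (norm (sg_iterate \<Omega> \<eta> h x n - u))\<^sup>2
    \<le> (norm (x - u))\<^sup>2 + real n * (\<eta>\<^sup>2 * G\<^sup>2)"
proof (induction n)
  case (Suc n)
  let ?y = "sg_iterate \<Omega> \<eta> h x n"
  have "?y \<in> \<Omega>"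
    by (rule sg_iterate_in_domain[OF x])
  then have "2 * \<eta> * (F ?y - F u) + (norm (sg_iterate \<Omega> \<eta> h x (Suc n) - u))\<^sup>2
      \<le> (norm (?y - u))\<^sup>2 + \<eta>\<^sup>2 * G\<^sup>2"
    using projected_step[OF _ u \<open>\<eta> \<ge> 0\<close> h] by simp
  with Suc show ?case
    by (simp add: algebra_simps)
qed simp

text \<open>The steps telescope, and Jensen's inequality passes from the mean of the values to the value at the
  mean.\<close>

lemma sg_average_gap:
  assumes x: "x \<in> \<Omega>" and u: "u \<in> \<Omega>" and "\<eta> > 0" and "t > 0"
    and h: "\<And>\<tau> y. y \<in> \<Omega> \<Longrightarrow> h \<tau> y \<in> bounded_subdifferential y"
  shows "F (sg_average \<Omega> \<eta> h x t) - F u \<le> \<eta> * G\<^sup>2 / 2 + (norm (x - u))\<^sup>2 / (2 * \<eta> * real t)"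
proof -
  let ?y = "\<lambda>\<tau>. sg_iterate \<Omega> \<eta> h x (\<tau> - 1)"
  define \<Sigma> where "\<Sigma> = (\<Sum>\<tau>=1..t. F (?y \<tau>) - F u)"
  have "F (\<Sum>\<tau>=1..t. (1 / real t) *\<^sub>R ?y \<tau>) \<le> (\<Sum>\<tau>=1..t. (1 / real t) * F (?y \<tau>))"
    using \<open>t > 0\<close> by (intro convex_on_sum[OF _ _ convex_on_F] sg_iterate_in_domain[OF x]) auto
  then have "F (sg_average \<Omega> \<eta> h x t) - F u \<le> (\<Sum>\<tau>=1..t. (1 / real t) * F (?y \<tau>)) - F u"
    by (simp add: sg_average_def scaleR_sum_right)
  also have "\<dots> = \<Sigma> / real t"
    using \<open>t > 0\<close> by (simp add: \<Sigma>_def sum_subtractf sum_divide_distrib[symmetric] diff_divide_distrib)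
  also have "\<dots> \<le> \<eta> * G\<^sup>2 / 2 + (norm (x - u))\<^sup>2 / (2 * \<eta> * real t)"
  proof -
    have "2 * \<eta> * \<Sigma> + (norm (sg_iterate \<Omega> \<eta> h x t - u))\<^sup>2 \<le> (norm (x - u))\<^sup>2 + real t * (\<eta>\<^sup>2 * G\<^sup>2)"
      unfolding \<Sigma>_def by (rule sg_iterate_telescope[OF x u _ h]) (use \<open>\<eta> > 0\<close> in auto)
    then have "2 * \<eta> * \<Sigma> \<le> (norm (x - u))\<^sup>2 + real t * (\<eta>\<^sup>2 * G\<^sup>2)"
      by (smt (verit) zero_le_power2)
    then show ?thesis
      using \<open>\<eta> > 0\<close> \<open>t > 0\<close> by (simp add: field_simps power2_eq_square)
  qed
  finally show ?thesis .
qed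

section \<open>One call of RSG\<close>

lemma rsg_in_domain:
  assumes "w \<in> \<Omega>" and "t > 0"
  shows "rsg \<Omega> \<epsilon>0 G h w k t \<alpha> \<in> \<Omega>"
  by (induction k) (auto simp: assms sg_average_in_domain)

text \<open>With \<open>e = \<epsilon>0 / \<alpha>\<^bsup>k\<^esup>\<close> and \<open>\<eta> = e / G\<^sup>2\<close>, both terms of \<open>sg_average_gap\<close> are at most \<open>e / 2\<close>: the first
  by the choice of \<open>\<eta>\<close>, the second because the excess before the stage is \<open>\<alpha> e\<close> and \<open>t\<close> absorbs the square
  of \<open>\<alpha> c G \<delta>\<^bsup>\<theta>-1\<^esup>\<close>. Since the comparison point has gap at most \<open>\<delta>\<close>, the excess drops from \<open>\<alpha> e\<close> to \<open>e\<close>.\<close>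

lemma rsg_gap:
  assumes w: "w \<in> \<Omega>" and gap: "F w - m \<le> \<delta> + \<epsilon>0"
    and pos: "\<delta> > 0" "\<epsilon>0 > 0" "\<theta> \<ge> 0" "c \<ge> 0" "\<alpha> > 0" "t > 0"
    and eb: "error_bound \<delta> \<theta> c"
    and t: "(\<alpha> * c * G * \<delta> powr (\<theta> - 1))\<^sup>2 \<le> real t"
    and h: "\<And>k \<tau> y. y \<in> \<Omega> \<Longrightarrow> h k \<tau> y \<in> bounded_subdifferential y"
  shows "F (rsg \<Omega> \<epsilon>0 G h w k t \<alpha>) - m \<le> \<delta> + \<epsilon>0 / \<alpha> ^ k"
proof (induction k)
  case 0
  with gap show ?case by simp
next
  case (Suc k)
  define x where "x = rsg \<Omega> \<epsilon>0 G h w k t \<alpha>"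
  define e where "e = \<epsilon>0 / \<alpha> ^ Suc k"
  define B where "B = c * \<delta> powr (\<theta> - 1)"
  define \<eta> where "\<eta> = e / G\<^sup>2"
  have e: "e > 0" "\<epsilon>0 / \<alpha> ^ k = \<alpha> * e"
    using pos by (auto simp: e_def)
  have \<eta>: "\<eta> > 0" "\<epsilon>0 / (\<alpha> ^ Suc k * G\<^sup>2) = \<eta>"
    using e(1) G_pos by (simp_all add: \<eta>_def) (simp add: e_def)
  have x: "x \<in> \<Omega>"
    unfolding x_def by (rule rsg_in_domain[OF w pos(6)])
  have "F x - m \<le> \<delta> + \<alpha> * e"
    using Suc e(2) by (simp add: x_def)
  then obtain u where u: "u \<in> sublevel \<delta>" and dist_u: "norm (x - u) \<le> B * (\<alpha> * e)"
    unfolding B_def using near_sublevel_point[OF x _ pos(1) _ pos(3,4) eb, of "\<alpha> * e"] pos e by auto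
  have "(norm (x - u))\<^sup>2 \<le> (B * (\<alpha> * e))\<^sup>2"
    using dist_u by (intro power_mono) auto
  also have "\<dots> = (\<alpha> * c * G * \<delta> powr (\<theta> - 1))\<^sup>2 * (e\<^sup>2 / G\<^sup>2)"
    using G_pos by (simp add: B_def power_mult_distrib)
  also have "\<dots> \<le> real t * (e\<^sup>2 / G\<^sup>2)"
    using t by (intro mult_right_mono) auto
  finally have "(norm (x - u))\<^sup>2 / (2 * \<eta> * real t) \<le> real t * (e\<^sup>2 / G\<^sup>2) / (2 * \<eta> * real t)"
    using \<eta>(1) by (intro divide_right_mono) auto
  also have "\<dots> = e / 2"
    using pos(6) e(1) G_pos by (simp add: \<eta>_def power2_eq_square field_simps)
  finally have second_term: "(norm (x - u))\<^sup>2 / (2 * \<eta> * real t) \<le> e / 2" .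
  have "F (sg_average \<Omega> \<eta> (h (Suc k)) x t) - F u
      \<le> \<eta> * G\<^sup>2 / 2 + (norm (x - u))\<^sup>2 / (2 * \<eta> * real t)"
    using sg_average_gap[OF x _ \<eta>(1) pos(6) h] u by (simp add: sublevel_def)
  moreover have "\<eta> * G\<^sup>2 / 2 = e / 2"
    using G_pos by (simp add: \<eta>_def)
  moreover have "F u \<le> m + \<delta>"
    using u by (simp add: sublevel_def)
  ultimately have "F (sg_average \<Omega> \<eta> (h (Suc k)) x t) - m \<le> \<delta> + e"
    using second_term by linarith
  then show ?case
    by (simp only: rsg.simps \<eta>(2) x_def e_def)
qed

section \<open>Restarting with longer and longer calls\<close>

text \<open>Call \<open>n + 1\<close> is analysed by \<open>rsg_gap\<close> at the level \<open>\<delta> = \<epsilon>1 / 2\<^bsup>n\<^esup>\<close>. Of the previous call only its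
  gap being at most \<open>\<epsilon>1 + \<epsilon> \<le> \<epsilon>0\<close> matters: progress between calls comes from the smaller \<open>\<delta>\<close>, not
  from the better starting point.\<close>

lemma r2sg_in_domain_and_gap:
  assumes w0: "w0 \<in> \<Omega>" "F w0 - m \<le> \<epsilon>0"
    and pos: "\<epsilon>1 > 0" "\<epsilon>0 > 0" "\<theta> \<ge> 0" "c \<ge> 0" "\<alpha> > 0" "t1 > 0"
    and eb: "error_bound \<epsilon>1 \<theta> c"
    and t1: "real t1 = \<alpha>\<^sup>2 * c\<^sup>2 * G\<^sup>2 / \<epsilon>1 powr (2 * (1 - \<theta>))"
    and g: "\<And>s k \<tau> y. y \<in> \<Omega> \<Longrightarrow> g s k \<tau> y \<in> bounded_subdifferential y"
    and K: "\<epsilon>0 / \<alpha> ^ K \<le> \<epsilon>" and start: "\<epsilon>1 + \<epsilon> \<le> \<epsilon>0"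
  shows "r2sg \<Omega> \<epsilon>0 G g w0 t1 K \<alpha> \<theta> (Suc n) \<in> \<Omega> \<and>
    F (r2sg \<Omega> \<epsilon>0 G g w0 t1 K \<alpha> \<theta> (Suc n)) - m \<le> \<epsilon>1 / 2 ^ n + \<epsilon>"
proof -
  have t_pos: "r2sg_t t1 \<theta> (Suc s) > 0" for s
    using pos by (simp add: r2sg_t_def)
  have one_call: "rsg \<Omega> \<epsilon>0 G (g (Suc s)) w K (r2sg_t t1 \<theta> (Suc s)) \<alpha> \<in> \<Omega> \<and>
      F (rsg \<Omega> \<epsilon>0 G (g (Suc s)) w K (r2sg_t t1 \<theta> (Suc s)) \<alpha>) - m \<le> \<epsilon>1 / 2 ^ s + \<epsilon>"
    if w: "w \<in> \<Omega>" "F w - m \<le> \<epsilon>0" for s w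
  proof -
    define \<delta> where "\<delta> = \<epsilon>1 / 2 ^ s"
    have \<delta>: "\<delta> > 0" "\<delta> \<le> \<epsilon>1"
      using pos by (auto simp: \<delta>_def field_simps)
    \<comment> \<open>Halving \<open>\<delta>\<close> costs precisely the factor by which the calls are lengthened.\<close>
    have "(\<alpha> * c * G * \<delta> powr (\<theta> - 1))\<^sup>2 = \<alpha>\<^sup>2 * c\<^sup>2 * G\<^sup>2 * \<delta> powr (-(2 * (1 - \<theta>)))"
      using \<delta>(1) by (simp add: power_mult_distrib powr_power algebra_simps)
    also have "\<delta> powr (-(2 * (1 - \<theta>)))
        = \<epsilon>1 powr (-(2 * (1 - \<theta>))) * 2 powr (real s * (2 * (1 - \<theta>)))"
    proof -
      have "\<delta> = \<epsilon>1 * 2 powr (- real s)"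
        by (simp add: \<delta>_def powr_minus powr_realpow divide_inverse)
      then show ?thesis
        using pos by (simp add: powr_mult powr_powr algebra_simps)
    qed
    also have "\<alpha>\<^sup>2 * c\<^sup>2 * G\<^sup>2 * (\<epsilon>1 powr (-(2 * (1 - \<theta>))) * 2 powr (real s * (2 * (1 - \<theta>))))
        = real t1 * 2 powr (2 * (real (Suc s) - 1) * (1 - \<theta>))"
      by (simp only: t1 powr_minus divide_inverse of_nat_Suc add_diff_cancel_left' mult_ac)
    also have "\<dots> \<le> real (r2sg_t t1 \<theta> (Suc s))"
      unfolding r2sg_t_def by (rule real_nat_ceiling_ge)
    finally have t: "(\<alpha> * c * G * \<delta> powr (\<theta> - 1))\<^sup>2 \<le> real (r2sg_t t1 \<theta> (Suc s))" .
    have "F w - m \<le> \<delta> + \<epsilon>0"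
      using w(2) \<delta>(1) by linarith
    then have "F (rsg \<Omega> \<epsilon>0 G (g (Suc s)) w K (r2sg_t t1 \<theta> (Suc s)) \<alpha>) - m \<le> \<delta> + \<epsilon>0 / \<alpha> ^ K"
      by (intro rsg_gap[OF w(1) _ \<delta>(1) pos(2-5) t_pos error_bound_antimono[OF eb \<delta>(2)] t] g)
    with K rsg_in_domain[OF w(1) t_pos] show ?thesis
      by (simp add: \<delta>_def)
  qed
  show ?thesis
  proof (induction n)
    case 0
    show ?case
      using one_call[OF w0, of 0] by simp
  next
    case (Suc n)
    have "\<epsilon>1 / 2 ^ n \<le> \<epsilon>1"
      using pos by (simp add: field_simps)
    with Suc start have "F (r2sg \<Omega> \<epsilon>0 G g w0 t1 K \<alpha> \<theta> (Suc n)) - m \<le> \<epsilon>0"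
      by linarith
    then show ?case
      using one_call[of "r2sg \<Omega> \<epsilon>0 G g w0 t1 K \<alpha> \<theta> (Suc n)" "Suc n"] Suc by simp
  qed
qed

end

section \<open>The number of iterations\<close>

text \<open>Before rounding, the call lengths form a geometric progression whose ratio exceeds one because
  \<open>\<theta> < 1\<close>. All its terms are at least one, so rounding up at most doubles them.\<close>

lemma sum_r2sg_t_le:
  assumes "\<theta> < 1" and "t1 > 0"
  defines "r \<equiv> 2 powr (2 * (1 - \<theta>))"
  shows "real (\<Sum>s=1..S. r2sg_t t1 \<theta> s) \<le> 2 * real t1 * r ^ S / (r - 1)"
proof -
  have r: "r > 1"
    using \<open>\<theta> < 1\<close> unfolding r_def by (intro gr_one_powr) auto
  have term_le: "real (r2sg_t t1 \<theta> (Suc s)) \<le> 2 * real t1 * r ^ s" for s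
  proof -
    have "2 powr (2 * (real (Suc s) - 1) * (1 - \<theta>)) = r ^ s"
      by (simp add: r_def powr_power mult_ac)
    then have "real (r2sg_t t1 \<theta> (Suc s)) \<le> real t1 * r ^ s + 1"
      using r of_int_ceiling_le_add_one[of "real t1 * r ^ s"]
      by (simp add: r2sg_t_def)
    moreover have "1 \<le> real t1 * r ^ s"
      using mult_mono[of 1 "real t1" 1 "r ^ s"] r \<open>t1 > 0\<close> by simp
    ultimately show ?thesis by simp
  qed
  have "real (\<Sum>s=1..S. r2sg_t t1 \<theta> s) = (\<Sum>s<S. real (r2sg_t t1 \<theta> (Suc s)))"
    by (simp add: sum.atLeast1_atMost_eq)
  also have "\<dots> \<le> (\<Sum>s<S. 2 * real t1 * r ^ s)"
    by (intro sum_mono term_le)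
  also have "\<dots> = 2 * real t1 * ((r ^ S - 1) / (r - 1))"
    using r by (simp add: sum_distrib_left[symmetric] geometric_sum)
  also have "\<dots> \<le> 2 * real t1 * (r ^ S / (r - 1))"
    using r by (intro mult_left_mono divide_right_mono) auto
  finally show ?thesis by simp
qed

text \<open>With \<open>S \<le> log 2 (\<epsilon>1 / \<epsilon>) + 2\<close> the last geometric term is at most
  \<open>r\<^sup>2 (\<epsilon>1 / \<epsilon>)\<^bsup>2(1-\<theta>)\<^esup>\<close>, and the power of \<open>\<epsilon>1\<close> cancels against the one in \<open>t1\<close>.\<close>

lemma r2sg_iterations_le:
  assumes "\<theta> < 1" and "t1 > 0" and "0 < \<epsilon>" and "\<epsilon> < \<epsilon>1"
    and t1: "real t1 = A / \<epsilon>1 powr (2 * (1 - \<theta>))"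
    and S: "S = nat \<lceil>log 2 (\<epsilon>1 / \<epsilon>)\<rceil> + 1"
  defines "r \<equiv> 2 powr (2 * (1 - \<theta>))"
  shows "real (r2sg_iterations t1 K \<theta> S)
    \<le> 2 * r\<^sup>2 / (r - 1) * (A / \<epsilon> powr (2 * (1 - \<theta>)) * real K)"
proof -
  let ?p = "2 * (1 - \<theta>)"
  have r: "r > 1"
    using \<open>\<theta> < 1\<close> unfolding r_def by (intro gr_one_powr) auto
  have log_pos: "0 < log 2 (\<epsilon>1 / \<epsilon>)"
    using assms by simp
  have "r ^ S = 2 powr (real S * ?p)"
    by (simp add: r_def powr_power mult_ac)
  also have "\<dots> \<le> 2 powr ((log 2 (\<epsilon>1 / \<epsilon>) + 2) * ?p)"
  proof -
    have "real S \<le> log 2 (\<epsilon>1 / \<epsilon>) + 2"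
      using log_pos of_int_ceiling_le_add_one[of "log 2 (\<epsilon>1 / \<epsilon>)"] unfolding S by linarith
    then show ?thesis
      using \<open>\<theta> < 1\<close> by (intro powr_mono mult_right_mono) auto
  qed
  also have "\<dots> = (2 powr log 2 (\<epsilon>1 / \<epsilon>)) powr ?p * (2 powr 2) powr ?p"
    by (simp only: powr_powr powr_add distrib_right)
  also have "(2 powr 2) powr ?p = r\<^sup>2"
    by (simp only: r_def power2_eq_square powr_powr powr_add[symmetric] mult_2)
  also have "2 powr log 2 (\<epsilon>1 / \<epsilon>) = \<epsilon>1 / \<epsilon>"
    using assms by simp
  finally have rS: "r ^ S \<le> (\<epsilon>1 / \<epsilon>) powr ?p * r\<^sup>2" .
  have "real (\<Sum>s=1..S. r2sg_t t1 \<theta> s) \<le> 2 * real t1 * r ^ S / (r - 1)"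
    unfolding r_def by (rule sum_r2sg_t_le[OF assms(1,2)])
  also have "\<dots> \<le> 2 * real t1 * ((\<epsilon>1 / \<epsilon>) powr ?p * r\<^sup>2) / (r - 1)"
    using r rS by (intro divide_right_mono mult_left_mono) auto
  also have "\<dots> = 2 * r\<^sup>2 / (r - 1) * (A / \<epsilon> powr ?p)"
    using assms by (simp add: t1 powr_divide mult_ac)
  finally have "real K * real (\<Sum>s=1..S. r2sg_t t1 \<theta> s)
      \<le> real K * (2 * r\<^sup>2 / (r - 1) * (A / \<epsilon> powr ?p))"
    by (rule mult_left_mono) simp
  then show ?thesis
    by (simp add: r2sg_iterations_def mult_ac)
qed

section \<open>Extended-real objective functions\<close>

theorem theorem15:
  fixes f :: "real ^ 'd \<Rightarrow> ereal" and \<Omega> :: "(real ^ 'd) set"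
    and G \<theta> \<alpha> \<epsilon>0 \<epsilon>1 c :: real and t1 :: nat
  assumes "\<And>x. f x \<noteq> -\<infinity>"
    and "lower_semicont f"
    and "ereal_convex f"
    and "closed \<Omega>" and "convex \<Omega>" and "\<Omega> \<subseteq> eff_dom f"
    and "opt_set f \<Omega> \<noteq> {}"
    and "G > 0"
    and "\<And>w. w \<in> \<Omega> \<Longrightarrow> subdifferential f w \<noteq> {}"
    and "\<And>w v. w \<in> \<Omega> \<Longrightarrow> v \<in> subdifferential f w \<Longrightarrow> norm v \<le> G"
    and "0 < \<theta>" and "\<theta> < 1"
    and "\<alpha> > 1"
    and "\<epsilon>0 > 0"
    and "\<epsilon>1 < \<epsilon>0 / 2"
    and "c > 0"
    and "local_error_bound f \<Omega> \<epsilon>1 \<theta> c"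
    and "t1 > 0"
    and "real t1 = \<alpha>\<^sup>2 * c\<^sup>2 * G\<^sup>2 / \<epsilon>1 powr (2 * (1 - \<theta>))"
  shows "\<exists>C>0. \<forall>\<epsilon> K S. 0 < \<epsilon> \<and> \<epsilon> \<le> \<epsilon>0 / 4 \<and> \<epsilon> < \<epsilon>1
      \<and> K = nat \<lceil>log \<alpha> (\<epsilon>0 / \<epsilon>)\<rceil> \<and> S = nat \<lceil>log 2 (\<epsilon>1 / \<epsilon>)\<rceil> + 1 \<longrightarrow>
    (\<forall>g w0. subgradient_oracle f \<Omega> g \<and> w0 \<in> \<Omega> \<and> f w0 - opt_value f \<Omega> \<le> ereal \<epsilon>0 \<longrightarrow>
      r2sg \<Omega> \<epsilon>0 G g w0 t1 K \<alpha> \<theta> S \<in> \<Omega> \<and>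
      f (r2sg \<Omega> \<epsilon>0 G g w0 t1 K \<alpha> \<theta> S) - opt_value f \<Omega> \<le> ereal (2 * \<epsilon>)) \<and>
    real (r2sg_iterations t1 K \<theta> S)
      \<le> C * (c\<^sup>2 * G\<^sup>2 / \<epsilon> powr (2 * (1 - \<theta>)) * \<lceil>log \<alpha> (\<epsilon>0 / \<epsilon>)\<rceil>)"
proof -
  note finite_below = assms(1) and dom = assms(6) and opt_nonempty = assms(7)
    and subdiff_nonempty = assms(9) and subdiff_bounded = assms(10) and eb = assms(17) and t1 = assms(19)
  \<comment> \<open>Outside \<open>\<Omega>\<close>, where \<open>f\<close> may be infinite, the values of \<open>F\<close> are meaningless and never inspected.\<close>
  define F where "F w = real_of_ereal (f w)" for w
  have f_eq: "f w = ereal (F w)" if "w \<in> \<Omega>" for w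
    using that finite_below[of w] dom by (cases "f w") (auto simp: F_def eff_dom_def)
  obtain z where z: "z \<in> \<Omega>" "\<forall>u\<in>\<Omega>. f z \<le> f u"
    using opt_nonempty by (auto simp: opt_set_def)
  define m where "m = F z"
  have opt_eq: "opt_value f \<Omega> = ereal m"
    unfolding opt_value_def m_def using z f_eq[OF z(1)]
    by (intro antisym) (auto intro: INF_lower2 INF_greatest)
  have subgradient: "norm v \<le> G \<and> (\<forall>u\<in>\<Omega>. F w + v \<bullet> (u - w) \<le> F u)"
    if w: "w \<in> \<Omega>" and v: "v \<in> subdifferential f w" for w v
  proof (intro conjI ballI)
    show "norm v \<le> G"
      using subdiff_bounded[OF w v] .
    fix u assume u: "u \<in> \<Omega>"
    have "f w + ereal (v \<bullet> (u - w)) \<le> f u"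
      using v by (simp add: subdifferential_def)
    then show "F w + v \<bullet> (u - w) \<le> F u"
      by (simp add: f_eq[OF w] f_eq[OF u])
  qed
  interpret bounded_subgradients F \<Omega> G m
  proof
    show "closed \<Omega>" "convex \<Omega>" "G > 0"
      by fact+
    show "\<exists>z\<in>\<Omega>. F z = m"
      using z by (auto simp: m_def)
    show "m \<le> F w" if "w \<in> \<Omega>" for w
      using z that by (auto simp: m_def f_eq)
    show "\<exists>v. norm v \<le> G \<and> (\<forall>u\<in>\<Omega>. F w + v \<bullet> (u - w) \<le> F u)" if "w \<in> \<Omega>" for w
      using subgradient[OF that] subdiff_nonempty[OF that] by blast
  qed
  have opt_set_eq: "opt_set f \<Omega> = minimizers"
  proof -
    have "(\<forall>u\<in>\<Omega>. f w \<le> f u) \<longleftrightarrow> F w = m" if "w \<in> \<Omega>" for w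
      using min_le that z(1) by (auto simp: m_def f_eq intro: antisym)
    then show ?thesis
      by (auto simp: opt_set_def minimizers_def)
  qed
  have "error_bound \<epsilon>1 \<theta> c"
    unfolding error_bound_def
  proof
    fix w assume "w \<in> sublevel \<epsilon>1"
    then have w: "w \<in> \<Omega>" "F w \<le> m + \<epsilon>1"
      by (auto simp: sublevel_def)
    then have "w \<in> sublevel_set f \<Omega> \<epsilon>1"
      by (simp add: sublevel_set_def opt_eq f_eq)
    then have "norm (w - closest_point (opt_set f \<Omega>) w)
        \<le> c * real_of_ereal (f w - opt_value f \<Omega>) powr \<theta>"
      using eb unfolding local_error_bound_def by blast
    then show "norm (w - closest_point minimizers w) \<le> c * (F w - m) powr \<theta>"
      by (simp add: opt_set_eq opt_eq f_eq[OF w(1)])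
  qed
  define r :: real where "r = 2 powr (2 * (1 - \<theta>))"
  have r: "r > 1"
    using \<open>\<theta> < 1\<close> unfolding r_def by (intro gr_one_powr) auto
  \<comment> \<open>\<open>\<alpha>\<^sup>2\<close> is the part of the numerator of \<open>t1\<close> that the claimed bound does not display; the other
    factor comes from summing and rounding the call lengths.\<close>
  define C where "C = 2 * r\<^sup>2 / (r - 1) * \<alpha>\<^sup>2"
  show ?thesis
  proof (intro exI[of _ C] conjI allI impI)
    show "C > 0"
      unfolding C_def using r \<open>\<alpha> > 1\<close> by (intro mult_pos_pos divide_pos_pos) auto
  next
    fix \<epsilon> K S
    assume "0 < \<epsilon> \<and> \<epsilon> \<le> \<epsilon>0 / 4 \<and> \<epsilon> < \<epsilon>1
      \<and> K = nat \<lceil>log \<alpha> (\<epsilon>0 / \<epsilon>)\<rceil> \<and> S = nat \<lceil>log 2 (\<epsilon>1 / \<epsilon>)\<rceil> + 1"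
    then have \<epsilon>: "0 < \<epsilon>" "\<epsilon> \<le> \<epsilon>0 / 4" "\<epsilon> < \<epsilon>1" and K: "K = nat \<lceil>log \<alpha> (\<epsilon>0 / \<epsilon>)\<rceil>"
      and S: "S = nat \<lceil>log 2 (\<epsilon>1 / \<epsilon>)\<rceil> + 1"
      by auto
    have "log \<alpha> (\<epsilon>0 / \<epsilon>) > 0"
      using \<epsilon> \<open>\<alpha> > 1\<close> \<open>\<epsilon>0 > 0\<close> by simp
    then have K_real: "real K = \<lceil>log \<alpha> (\<epsilon>0 / \<epsilon>)\<rceil>"
      using K by simp
    have "real (r2sg_iterations t1 K \<theta> S)
        \<le> 2 * r\<^sup>2 / (r - 1) * (\<alpha>\<^sup>2 * c\<^sup>2 * G\<^sup>2 / \<epsilon> powr (2 * (1 - \<theta>)) * real K)"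
      unfolding r_def by (rule r2sg_iterations_le[OF \<open>\<theta> < 1\<close> \<open>t1 > 0\<close> \<epsilon>(1,3) t1 S])
    then show "real (r2sg_iterations t1 K \<theta> S)
        \<le> C * (c\<^sup>2 * G\<^sup>2 / \<epsilon> powr (2 * (1 - \<theta>)) * \<lceil>log \<alpha> (\<epsilon>0 / \<epsilon>)\<rceil>)"
      by (simp add: C_def K_real[symmetric] mult_ac)
    fix g w0
    assume run: "subgradient_oracle f \<Omega> g \<and> w0 \<in> \<Omega> \<and> f w0 - opt_value f \<Omega> \<le> ereal \<epsilon>0"
    define w where "w = r2sg \<Omega> \<epsilon>0 G g w0 t1 K \<alpha> \<theta> S"
    define n where "n = nat \<lceil>log 2 (\<epsilon>1 / \<epsilon>)\<rceil>"
    have g: "g s k \<tau> y \<in> bounded_subdifferential y" if "y \<in> \<Omega>" for s k \<tau> y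
      using subgradient[OF that] run that
      by (auto simp: bounded_subdifferential_def subgradient_oracle_def)
    have "\<epsilon>0 / \<epsilon> = \<alpha> powr log \<alpha> (\<epsilon>0 / \<epsilon>)"
      using \<epsilon> \<open>\<alpha> > 1\<close> \<open>\<epsilon>0 > 0\<close> by simp
    also have "\<dots> \<le> \<alpha> powr real K"
      using \<open>\<alpha> > 1\<close> unfolding K by (intro powr_mono real_nat_ceiling_ge) auto
    finally have K_large: "\<epsilon>0 / \<alpha> ^ K \<le> \<epsilon>"
      using \<epsilon> \<open>\<alpha> > 1\<close> by (simp add: powr_realpow field_simps)
    have "\<epsilon>1 / \<epsilon> = 2 powr log 2 (\<epsilon>1 / \<epsilon>)"
      using \<epsilon> by simp
    also have "\<dots> \<le> 2 powr real n"
      unfolding n_def by (intro powr_mono real_nat_ceiling_ge) auto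
    finally have n_large: "\<epsilon>1 / 2 ^ n \<le> \<epsilon>"
      using \<epsilon> by (simp add: powr_realpow field_simps)
    have "w \<in> \<Omega> \<and> F w - m \<le> \<epsilon>1 / 2 ^ n + \<epsilon>"
    proof -
      have "F w0 - m \<le> \<epsilon>0"
        using run by (auto simp: opt_eq f_eq)
      moreover have "\<epsilon>1 + \<epsilon> \<le> \<epsilon>0"
        using \<epsilon> \<open>\<epsilon>1 < \<epsilon>0 / 2\<close> by linarith
      ultimately have "r2sg \<Omega> \<epsilon>0 G g w0 t1 K \<alpha> \<theta> (Suc n) \<in> \<Omega> \<and>
          F (r2sg \<Omega> \<epsilon>0 G g w0 t1 K \<alpha> \<theta> (Suc n)) - m \<le> \<epsilon>1 / 2 ^ n + \<epsilon>"
        using run \<epsilon> \<open>\<epsilon>0 > 0\<close> \<open>0 < \<theta>\<close> \<open>c > 0\<close> \<open>\<alpha> > 1\<close> \<open>t1 > 0\<close>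
        by (intro r2sg_in_domain_and_gap[OF _ _ _ _ _ _ _ _ \<open>error_bound \<epsilon>1 \<theta> c\<close> t1 g K_large]) auto
      then show ?thesis
        by (simp add: w_def S n_def)
    qed
    then show "w \<in> \<Omega>" and "f w - opt_value f \<Omega> \<le> ereal (2 * \<epsilon>)"
      using n_large by (auto simp: opt_eq f_eq)
  qed
qed

end
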